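(* There exist unitaries $V_0, V_1, V_2, V_3, V_4$ acting on four qubits (three ancilla qubits, labelled $1,2,3$, and one target qubit), all independent of $U$, with the following property. For every $U \in SU(2)$ define $$C_{\mathrm{IV}}(U) = V_4\,(I_{123}\otimes U)\,V_3\,(I_{123}\otimes U)\,V_2\,(I_{123}\otimes U)\,V_1\,(I_{123}\otimes U)\,V_0,$$ where $I_{123}$ is the identity on the three ancilla qubits and $U$ acts on the target qubit; thus $U$ is used exactly 4 times. Then for every $U\in SU(2)$ there is a unit vector $|\chi_U\rangle$ on qubits $2,3$, independent of the input $|\psi\rangle$, such that for every single-qubit state $|\psi\rangle$ $$C_{\mathrm{IV}}(U)\,|0\rangle_1|0\rangle_2|0\rangle_3|\psi\rangle = |0\rangle_1\otimes|\chi_U\rangle_{23}\otimes U^{-1}|\psi\rangle .$$ Equivalently, after tracing out ancilla qubits $2$ and $3$, the output is $|0\rangle\langle 0|_1\otimes U^{-1}|\psi\rangle\langle\psi|U$. So $U^{-1}$ is implemented deterministically and exactly using 3 ancilla qubits and 4 queries of $U$.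
   Context: All systems are qubits ($\mathbb{C}^2$). $SU(2)$ denotes the $2\times 2$ unitary matrices with determinant $1$. For a general $U\in U(2)$, the same statement holds up to a global phase of the output state, that is, at the level of quantum channels. *)

theory Defs
  imports Complex_Main "Jordan_Normal_Form.Matrix" "Jordan_Normal_Form.Determinant"
begin

text \<open>Quantum-circuit conventions. An n-qubit operator is a complex
  2^n x 2^n matrix; a state is a complex vector of dimension 2^n.
  Tensor products are Kronecker products with the first factor as the most
  significant index (so qubit 1 is leftmost, the target qubit rightmost).\<close>

definition adjoint_mat :: "complex mat \<Rightarrow> complex mat" where
  "adjoint_mat A = mat (dim_col A) (dim_row A) (\<lambda>(i,j). cnj (A $$ (j,i)))"

definition unitary_mat :: "nat \<Rightarrow> complex mat \<Rightarrow> bool" where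
  "unitary_mat n A \<longleftrightarrow> A \<in> carrier_mat n n \<and> A * adjoint_mat A = 1\<^sub>m n
      \<and> adjoint_mat A * A = 1\<^sub>m n"

definition SU2 :: "complex mat set" where
  "SU2 = {U. unitary_mat 2 U \<and> det U = 1}"

definition kron_mat :: "complex mat \<Rightarrow> complex mat \<Rightarrow> complex mat" where
  "kron_mat A B = mat (dim_row A * dim_row B) (dim_col A * dim_col B)
     (\<lambda>(i,j). A $$ (i div dim_row B, j div dim_col B) * B $$ (i mod dim_row B, j mod dim_col B))"

definition kron_vec :: "complex vec \<Rightarrow> complex vec \<Rightarrow> complex vec" where
  "kron_vec v w = vec (dim_vec v * dim_vec w)
     (\<lambda>i. v $ (i div dim_vec w) * w $ (i mod dim_vec w))"

definition ket0 :: "complex vec" where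
  "ket0 = unit_vec 2 0"

definition unit_state :: "nat \<Rightarrow> complex vec \<Rightarrow> bool" where
  "unit_state n v \<longleftrightarrow> v \<in> carrier_vec n \<and> (\<Sum>i<n. (cmod (v $ i))\<^sup>2) = 1"

definition C_IV :: "complex mat \<Rightarrow> complex mat \<Rightarrow> complex mat \<Rightarrow> complex mat
    \<Rightarrow> complex mat \<Rightarrow> complex mat \<Rightarrow> complex mat" where
  "C_IV V0 V1 V2 V3 V4 U =
     (let W = kron_mat (1\<^sub>m 8) U in V4 * W * V3 * W * V2 * W * V1 * W * V0)"

end

theory Submission
  imports Defs
begin

text \<open>Label the four qubits f, x, y, t (t is the target) and let S be the singlet
  (|01> - |10>) / sqrt 2, which is invariant under U (x) U. Put
  e = psi_x S_yt and g = chi_xy (U^-1 psi)_t with chi_xy = U_x S_yx, all with f = 0. A query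
  maps e to s = psi_x (U_t S_yt), and g to s', which is s with x and t swapped.
  The goal is to turn e into g.

  Project s onto singlet and triplet of the pair (x,t). The singlet part is S_xt (U^-1 psi)_y, as
  in gate teleportation; it has weight 1/4 in s and in s', with opposite signs. A round consisting of
  a fixed unitary, a query and a fixed unitary treats the two parts separately: on the triplet part
  the query hits y, which undoes the first one and returns to e; on the singlet part,
  U^-1 psi is first embedded into (triplet) (x) (spin 1/2), and the query leads to the part
  of g orthogonal to e. Altogether one round maps
  alpha s + beta s' to ((alpha - beta) g - (2 alpha + beta) e) / sqrt 3.
  Two rounds suffice: s goes to (g - 2e) / sqrt 3, a query gives (s' - 2s) / sqrt 3, swapping x and t
  gives (s - 2s') / sqrt 3, and the second round maps this to g.\<close>

section \<open>Permutation matrices, reflections and their unitarity\<close>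

definition reindex_mat :: "nat list \<Rightarrow> complex mat" where
  "reindex_mat ks = mat (length ks) (length ks) (\<lambda>(i,j). if ks ! i = j then 1 else 0)"

text \<open>Householder reflection along \<open>ws\<close>; dividing by the squared norm lets
  \<open>ws\<close> stay unnormalised. Along the difference of two orthogonal unit vectors it
  exchanges these vectors, which is how it is used below.\<close>

definition reflection_mat :: "complex list \<Rightarrow> complex mat" where
  "reflection_mat ws = mat (length ws) (length ws)
     (\<lambda>(i,j). (if i = j then 1 else 0)
        - 2 * (ws ! i) * cnj (ws ! j) / (\<Sum>k<length ws. ws ! k * cnj (ws ! k)))"

lemma unitary_matI:
  assumes "A \<in> carrier_mat n n" and "A * adjoint_mat A = 1\<^sub>m n"
  shows "unitary_mat n A"
proof -
  have "adjoint_mat A \<in> carrier_mat n n"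
    using assms(1) by (simp add: adjoint_mat_def)
  then show ?thesis
    using assms mat_mult_left_right_inverse unfolding unitary_mat_def by blast
qed

lemma unitary_mat_carrier: "unitary_mat n A \<Longrightarrow> A \<in> carrier_mat n n"
  by (simp add: unitary_mat_def)

lemma adjoint_mat_mult:
  assumes "A \<in> carrier_mat n n" and "B \<in> carrier_mat n n"
  shows "adjoint_mat (A * B) = adjoint_mat B * adjoint_mat A"
  using assms
  by (intro eq_matI) (auto simp: adjoint_mat_def scalar_prod_def mult.commute)

lemma unitary_mat_mult:
  assumes A: "unitary_mat n A" and B: "unitary_mat n B"
  shows "unitary_mat n (A * B)"
proof (rule unitary_matI)
  have cA: "A \<in> carrier_mat n n" and cB: "B \<in> carrier_mat n n"
    using A B by (auto simp: unitary_mat_def)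
  then have dA: "adjoint_mat A \<in> carrier_mat n n" and dB: "adjoint_mat B \<in> carrier_mat n n"
    by (auto simp: adjoint_mat_def)
  show "A * B \<in> carrier_mat n n" using cA cB by simp
  have "A * B * adjoint_mat (A * B) = A * (B * adjoint_mat B) * adjoint_mat A"
    using cA cB dA dB by (simp add: adjoint_mat_mult assoc_mult_mat[of _ n n _ n _ n])
  also have "\<dots> = 1\<^sub>m n"
    using A B cA by (simp add: unitary_mat_def)
  finally show "A * B * adjoint_mat (A * B) = 1\<^sub>m n" .
qed

lemma unitary_reindex_mat:
  assumes "distinct ks" and "set ks \<subseteq> {..<length ks}"
  shows "unitary_mat (length ks) (reindex_mat ks)"
proof (rule unitary_matI)
  let ?n = "length ks"
  show "reindex_mat ks \<in> carrier_mat ?n ?n"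
    by (simp add: reindex_mat_def)
  show "reindex_mat ks * adjoint_mat (reindex_mat ks) = 1\<^sub>m ?n"
  proof (rule eq_matI)
    fix i j assume "i < dim_row (1\<^sub>m ?n :: complex mat)" "j < dim_col (1\<^sub>m ?n :: complex mat)"
    then have ij: "i < ?n" "j < ?n" by auto
    then have "ks ! i < ?n" using assms(2) nth_mem by blast
    then have "(\<Sum>k = 0..<?n. (if ks ! i = k then 1 else 0) * cnj (if ks ! j = k then 1 else 0))
        = (if ks ! j = ks ! i then 1 else 0)"
      by (subst sum.remove[of _ "ks ! i"]) (auto intro!: sum.neutral)
    also have "\<dots> = (if i = j then 1 else 0)"
      using ij assms(1) by (auto simp: nth_eq_iff_index_eq)
    finally show "(reindex_mat ks * adjoint_mat (reindex_mat ks)) $$ (i, j) = 1\<^sub>m ?n $$ (i, j)"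
      using ij by (simp add: reindex_mat_def adjoint_mat_def scalar_prod_def)
  qed (auto simp: reindex_mat_def adjoint_mat_def)
qed

lemma unitary_reflection_mat: "unitary_mat (length ws) (reflection_mat ws)"
proof (rule unitary_matI)
  let ?n = "length ws"
  define N where "N = (\<Sum>k<?n. ws ! k * cnj (ws ! k))"
  define R where "R = (\<lambda>i j. (if i = j then 1 else 0) - 2 * (ws ! i) * cnj (ws ! j) / N)"
  have R: "reflection_mat ws = mat ?n ?n (\<lambda>(i,j). R i j)"
    by (simp add: reflection_mat_def R_def N_def)
  have cN: "cnj N = N"
    by (simp add: N_def mult.commute)
  show "reflection_mat ws \<in> carrier_mat ?n ?n"
    by (simp add: reflection_mat_def)
  show "reflection_mat ws * adjoint_mat (reflection_mat ws) = 1\<^sub>m ?n"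
  proof (rule eq_matI)
    fix i j assume "i < dim_row (1\<^sub>m ?n :: complex mat)" "j < dim_col (1\<^sub>m ?n :: complex mat)"
    then have ij: "i < ?n" "j < ?n" by auto
    \<comment> \<open>As N is real, R i k is [i = k] minus x times cnj (ws ! k), and cnj (R j k) is
      [j = k] minus y times ws ! k. In the product each of the two linear terms is half of x * y *
      N; for N = 0 all of them are 0, since division by 0 gives 0.\<close>
    define x where "x = 2 * ws ! i / N"
    define y where "y = 2 * cnj (ws ! j) / N"
    have "(\<Sum>k<?n. R i k * cnj (R j k))
        = (\<Sum>k<?n. (if k = i then (if i = j then 1 else 0) else 0)
             - (if k = i then y * ws ! i else 0) - (if k = j then x * cnj (ws ! j) else 0)
             + x * y * (ws ! k * cnj (ws ! k)))"
      by (rule sum.cong) (auto simp: R_def x_def y_def cN algebra_simps)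
    also have "\<dots> = (if i = j then 1 else 0) - y * ws ! i - x * cnj (ws ! j) + x * y * N"
      using ij by (simp add: sum.distrib sum_subtractf sum_distrib_left[symmetric] N_def)
    also have "\<dots> = (if i = j then 1 else 0)"
      by (cases "N = 0") (auto simp: x_def y_def field_simps)
    finally show "(reflection_mat ws * adjoint_mat (reflection_mat ws)) $$ (i, j) = 1\<^sub>m ?n $$ (i, j)"
      using ij by (simp add: R adjoint_mat_def scalar_prod_def atLeast0LessThan)
  qed (auto simp: reflection_mat_def adjoint_mat_def)
qed

section \<open>Action of these matrices and of a query on explicit vectors\<close>

lemma reindex_mat_apply:
  assumes "length xs = length ks" and "set ks \<subseteq> {..<length ks}"
  shows "reindex_mat ks *\<^sub>v vec_of_list xs = vec_of_list (map (\<lambda>k. xs ! k) ks)"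
proof (rule eq_vecI)
  fix i assume "i < dim_vec (vec_of_list (map (\<lambda>k. xs ! k) ks))"
  then have i: "i < length ks" by simp
  then have "ks ! i < length ks" using assms(2) nth_mem by blast
  then have "(\<Sum>k = 0..<length ks. (if ks ! i = k then 1 else 0) * xs ! k) = xs ! (ks ! i)"
    by (subst sum.remove[of _ "ks ! i"]) (auto intro!: sum.neutral)
  then show "(reindex_mat ks *\<^sub>v vec_of_list xs) $ i = vec_of_list (map (\<lambda>k. xs ! k) ks) $ i"
    using i assms by (simp add: reindex_mat_def scalar_prod_def vec_of_list_index)
qed (simp add: reindex_mat_def)

lemma reflection_mat_apply:
  assumes "length xs = length ws"
  shows "reflection_mat ws *\<^sub>v vec_of_list xs
    = vec_of_list (map2 (\<lambda>w x. x - w * (2 * sum_list (map2 (\<lambda>w x. cnj w * x) ws xs)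
                                  / sum_list (map (\<lambda>w. w * cnj w) ws))) ws xs)"
    (is "_ = vec_of_list ?ys")
proof (rule eq_vecI)
  let ?n = "length ws"
  define N where "N = (\<Sum>k<?n. ws ! k * cnj (ws ! k))"
  have N: "sum_list (map (\<lambda>w. w * cnj w) ws) = N"
    by (simp add: N_def sum_list_sum_nth atLeast0LessThan)
  have S: "sum_list (map2 (\<lambda>w x. cnj w * x) ws xs) = (\<Sum>k<?n. cnj (ws ! k) * xs ! k)"
    using assms by (simp add: sum_list_sum_nth atLeast0LessThan)
  fix i assume "i < dim_vec (vec_of_list ?ys)"
  then have i: "i < ?n" using assms by simp
  have "(\<Sum>k<?n. ((if i = k then 1 else 0) - 2 * ws ! i * cnj (ws ! k) / N) * xs ! k)
     = (\<Sum>k<?n. (if k = i then xs ! i else 0) - (2 * ws ! i / N) * (cnj (ws ! k) * xs ! k))"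
    by (rule sum.cong) (auto simp: algebra_simps)
  also have "\<dots> = xs ! i - ws ! i * (2 * (\<Sum>k<?n. cnj (ws ! k) * xs ! k) / N)"
    using i by (simp only: sum_subtractf sum_distrib_left[symmetric]) simp
  finally show "(reflection_mat ws *\<^sub>v vec_of_list xs) $ i = vec_of_list ?ys $ i"
    using i assms
    by (simp add: reflection_mat_def scalar_prod_def atLeast0LessThan vec_of_list_index N S
        N_def[symmetric])
qed (use assms in \<open>simp add: reflection_mat_def\<close>)

text \<open>Explicit vectors stay \<open>vec_of_list\<close> of a literal list, the form on which
  the rules for applying matrices work.\<close>

declare vec_of_list_Cons [simp del]

lemma less_16_cases:
  fixes i :: nat
  assumes "i < 16"
  obtains "i = 0" | "i = 1" | "i = 2" | "i = 3" | "i = 4" | "i = 5" | "i = 6" | "i = 7" | "i = 8"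
    | "i = 9" | "i = 10" | "i = 11" | "i = 12" | "i = 13" | "i = 14" | "i = 15"
proof -
  have "i = 0 \<or> i = 1 \<or> i = 2 \<or> i = 3 \<or> i = 4 \<or> i = 5 \<or> i = 6 \<or> i = 7 \<or> i = 8 \<or>
      i = 9 \<or> i = 10 \<or> i = 11 \<or> i = 12 \<or> i = 13 \<or> i = 14 \<or> i = 15"
    using assms by presburger
  then show thesis
    using that by blast
qed

lemma query_apply:
  assumes U: "U \<in> carrier_mat 2 2" and
    entries: "U $$ (0,0) = a" "U $$ (0,1) = b" "U $$ (1,0) = c" "U $$ (1,1) = d"
  shows "kron_mat (1\<^sub>m 8) U *\<^sub>v vec_of_list [x0,x1,x2,x3,x4,x5,x6,x7,x8,x9,x10,x11,x12,x13,x14,x15]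
    = vec_of_list
      [a * x0 + b * x1, c * x0 + d * x1, a * x2 + b * x3, c * x2 + d * x3,
       a * x4 + b * x5, c * x4 + d * x5, a * x6 + b * x7, c * x6 + d * x7,
       a * x8 + b * x9, c * x8 + d * x9, a * x10 + b * x11, c * x10 + d * x11,
       a * x12 + b * x13, c * x12 + d * x13, a * x14 + b * x15, c * x14 + d * x15]"
    (is "_ *\<^sub>v vec_of_list ?xs = vec_of_list ?ys")
proof (rule eq_vecI)
  show dim: "dim_vec (kron_mat (1\<^sub>m 8) U *\<^sub>v vec_of_list ?xs) = dim_vec (vec_of_list ?ys)"
    using U by (simp add: kron_mat_def)
  have "[0..<16] = [0,1,2,3,4,5,6,7,8,9,10,11,12,13,14,15]"
    by (simp add: upt_rec)
  then have indices: "(\<Sum>k = 0..<16. f k)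
      = sum_list (map f [0,1,2,3,4,5,6,7,8,9,10,11,12,13,14,15])" for f :: "nat \<Rightarrow> complex"
    by (metis interv_sum_list_conv_sum_set_nat set_upt)
  fix i assume "i < dim_vec (vec_of_list ?ys)"
  then have "i < 16" by simp
  then show "(kron_mat (1\<^sub>m 8) U *\<^sub>v vec_of_list ?xs) $ i = vec_of_list ?ys $ i"
    using U entries
    by (elim less_16_cases) (simp_all add: kron_mat_def scalar_prod_def vec_of_list_index indices)
qed

section \<open>The fixed unitaries of the circuit\<close>

text \<open>From here on the index of a 16-dimensional vector is 8f + 4x + 2y + t. With u = 0, 1 and
  (1 + swap_xy) (S_xt u_y) / sqrt 3 as the embedding of spin 1/2 into (triplet of xy) (x) t, the two
  reflections exchange S_xt u_y at f = 0 with its embedding at f = 1.\<close>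

definition recouple_mat :: "complex mat" where
  "recouple_mat =
     reflection_mat [0, complex_of_real (sqrt 3), 0, 0, - complex_of_real (sqrt 3), 0, 0, 0, 0, - 2, 1, 0, 1, 0, 0, 0] *
     reflection_mat [0, 0, 0, complex_of_real (sqrt 3), 0, 0, - complex_of_real (sqrt 3), 0, 0, 0, 0, - 1, 0, - 1, 2, 0]"

text \<open>The swaps act on the half f = 0 only; exchange flips f and, when it comes from f = 1,
  also permutes x, y, t cyclically.\<close>

definition swap_yt :: "nat list" where
  "swap_yt = [0, 2, 1, 3, 4, 6, 5, 7, 8, 9, 10, 11, 12, 13, 14, 15]"

definition swap_xy :: "nat list" where
  "swap_xy = [0, 1, 4, 5, 2, 3, 6, 7, 8, 9, 10, 11, 12, 13, 14, 15]"

definition swap_xt :: "nat list" where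
  "swap_xt = [0, 4, 2, 6, 1, 5, 3, 7, 8, 9, 10, 11, 12, 13, 14, 15]"

definition exchange :: "nat list" where
  "exchange = [8, 12, 9, 13, 10, 14, 11, 15, 0, 1, 2, 3, 4, 5, 6, 7]"

text \<open>The permutation moves psi from t to x. The reflections, one for each value of x, run
  along |00> - S_yt and so send |00>_yt to S_yt.\<close>

definition prepare_mat :: "complex mat" where
  "prepare_mat =
     reflection_mat [complex_of_real (sqrt 2), - 1, 1, 0, 0, 0, 0, 0, 0, 0, 0, 0, 0, 0, 0, 0] *
     reflection_mat [0, 0, 0, 0, complex_of_real (sqrt 2), - 1, 1, 0, 0, 0, 0, 0, 0, 0, 0, 0] *
     reindex_mat [0, 4, 2, 3, 1, 5, 6, 7, 8, 9, 10, 11, 12, 13, 14, 15]"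

text \<open>The singlet part moves to f = 1 and will be queried on t. The triplet part stays at f =
  0, where the swap puts y on the queried wire.\<close>

definition odd_mat :: "complex mat" where
  "odd_mat = reindex_mat swap_yt * recouple_mat"

text \<open>The cyclic permutation turns the triplet pair x, y of the branch f = 1 into the pair t,
  x. That branch is then orthogonal to every S_xt u_y, so \<open>recouple_mat\<close> leaves it at f
  = 0. The other branch arrives at f = 1 in the embedded spin 1/2 and is brought back to S_xt psi_y,
  which the last swap turns into a multiple of e.\<close>

definition even_mat :: "complex mat" where
  "even_mat = reindex_mat swap_xy * recouple_mat * reindex_mat exchange"

lemma unitary_mat_factors:
  "unitary_mat 16 recouple_mat" "unitary_mat 16 prepare_mat"
  "unitary_mat 16 (reindex_mat swap_yt)" "unitary_mat 16 (reindex_mat swap_xy)"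
  "unitary_mat 16 (reindex_mat swap_xt)" "unitary_mat 16 (reindex_mat exchange)"
proof -
  have refl: "unitary_mat 16 (reflection_mat ws)" if "length ws = 16" for ws
    using unitary_reflection_mat[of ws] that by simp
  have perm: "unitary_mat 16 (reindex_mat ks)"
    if "distinct ks" "set ks \<subseteq> {..<16}" "length ks = 16" for ks
    using unitary_reindex_mat[of ks] that by simp
  show "unitary_mat 16 recouple_mat" "unitary_mat 16 prepare_mat"
    unfolding recouple_mat_def prepare_mat_def
    by (intro unitary_mat_mult refl perm; simp)+
  show "unitary_mat 16 (reindex_mat swap_yt)" "unitary_mat 16 (reindex_mat swap_xy)"
    "unitary_mat 16 (reindex_mat swap_xt)" "unitary_mat 16 (reindex_mat exchange)"
    by (intro perm; simp add: swap_yt_def swap_xy_def swap_xt_def exchange_def)+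
qed

lemma reflection_mat_carrier: "length ws = n \<Longrightarrow> reflection_mat ws \<in> carrier_mat n n"
  by (simp add: reflection_mat_def)

lemma reindex_mat_carrier: "length ks = n \<Longrightarrow> reindex_mat ks \<in> carrier_mat n n"
  by (simp add: reindex_mat_def)

lemma mult3_mat_vec:
  fixes A B C :: "complex mat"
  assumes "A \<in> carrier_mat n n" "B \<in> carrier_mat n n" "C \<in> carrier_mat n n" "x \<in> carrier_vec n"
  shows "(A * B * C) *\<^sub>v x = A *\<^sub>v (B *\<^sub>v (C *\<^sub>v x))"
  using assms by (simp add: assoc_mult_mat_vec[of _ n n _ n])

lemma sqrt3_sq: "complex_of_real (sqrt 3) * complex_of_real (sqrt 3) = 3"
  by (simp flip: of_real_mult)

lemma sqrt2_sq: "complex_of_real (sqrt 2) * complex_of_real (sqrt 2) = 2"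
  by (simp flip: of_real_mult)

text \<open>Both reflection vectors have squared norm 12, so \<open>c0\<close> and \<open>c1\<close>
  are inner products with the input times 2 / 12. The supports are disjoint, so the two reflections
  do not interfere.\<close>

lemma recouple_mat_apply:
  defines "r \<equiv> complex_of_real (sqrt 3)"
  shows "recouple_mat *\<^sub>v vec_of_list [x0,x1,x2,x3,x4,x5,x6,x7,x8,x9,x10,x11,x12,x13,x14,x15]
    = (let c0 = (r * (x1 - x4) - 2 * x9 + x10 + x12) / 6;
           c1 = (r * (x3 - x6) - x11 - x13 + 2 * x14) / 6
       in vec_of_list [x0, x1 - r * c0, x2, x3 - r * c1, x4 + r * c0, x5, x6 + r * c1, x7,
         x8, x9 + 2 * c0, x10 - c0, x11 + c1, x12 - c0, x13 + c1, x14 - 2 * c1, x15])"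
proof -
  have "recouple_mat *\<^sub>v vec_of_list [x0,x1,x2,x3,x4,x5,x6,x7,x8,x9,x10,x11,x12,x13,x14,x15]
   = reflection_mat [0, r, 0, 0, - r, 0, 0, 0, 0, - 2, 1, 0, 1, 0, 0, 0] *\<^sub>v
     (reflection_mat [0, 0, 0, r, 0, 0, - r, 0, 0, 0, 0, - 1, 0, - 1, 2, 0] *\<^sub>v
      vec_of_list [x0,x1,x2,x3,x4,x5,x6,x7,x8,x9,x10,x11,x12,x13,x14,x15])"
    unfolding recouple_mat_def r_def
    by (subst assoc_mult_mat_vec[of _ 16 16 _ 16]) (auto intro!: reflection_mat_carrier carrier_vecI)
  moreover have r: "cnj r = r" "r * r = 3" by (simp_all add: r_def sqrt3_sq)
  moreover have "r * (r * z) = 3 * z" for z using r by (simp flip: mult.assoc)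
  ultimately show ?thesis
    by (simp add: reflection_mat_apply Let_def)
      (intro arg_cong[of _ _ vec_of_list]; simp add: field_simps)
qed

section \<open>Evolution of e and g under queries and rounds\<close>

text \<open>sqrt 2 (gamma e + delta g) and sqrt 2 (gamma s + delta s') for psi = (p, q). The inverse of U is
  written as its adjugate, which keeps all identities below polynomial modulo det U = 1.\<close>

definition before_query :: "complex mat \<Rightarrow> complex \<Rightarrow> complex \<Rightarrow> complex \<Rightarrow> complex \<Rightarrow> complex list" where
  "before_query U p q \<gamma> \<delta> =
     (let a = U $$ (0,0); b = U $$ (0,1); c = U $$ (1,0); d = U $$ (1,1);
          m = d * p - b * q; n = a * q - c * p
      in [\<delta> * b * m, \<gamma> * p + \<delta> * b * n, - \<gamma> * p - \<delta> * a * m, - \<delta> * a * n,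
          \<delta> * d * m, \<gamma> * q + \<delta> * d * n, - \<gamma> * q - \<delta> * c * m, - \<delta> * c * n,
          0, 0, 0, 0, 0, 0, 0, 0])"

definition after_query :: "complex mat \<Rightarrow> complex \<Rightarrow> complex \<Rightarrow> complex \<Rightarrow> complex \<Rightarrow> complex list" where
  "after_query U p q \<gamma> \<delta> =
     (let a = U $$ (0,0); b = U $$ (0,1); c = U $$ (1,0); d = U $$ (1,1)
      in [\<gamma> * b * p + \<delta> * b * p, \<gamma> * d * p + \<delta> * b * q,
          - \<gamma> * a * p - \<delta> * a * p, - \<gamma> * c * p - \<delta> * a * q,
          \<gamma> * b * q + \<delta> * d * p, \<gamma> * d * q + \<delta> * d * q,
          - \<gamma> * a * q - \<delta> * c * p, - \<gamma> * c * q - \<delta> * c * q,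
          0, 0, 0, 0, 0, 0, 0, 0])"

text \<open>The result is e; the coefficient of g is 0, which is why \<open>U\<close> is
  arbitrary.\<close>

lemma prepare_mat_apply:
  "prepare_mat *\<^sub>v vec_of_list [p, q, 0, 0, 0, 0, 0, 0, 0, 0, 0, 0, 0, 0, 0, 0]
    = vec_of_list (before_query U p q (1 / sqrt 2) 0)"
proof -
  define r where "r = complex_of_real (sqrt 2)"
  have r: "cnj r = r" "r * r = 2" "r \<noteq> 0" by (simp_all add: r_def sqrt2_sq)
  moreover have "r * (r * z) = 2 * z" for z using r by (simp flip: mult.assoc)
  moreover have "prepare_mat *\<^sub>v vec_of_list [p, q, 0, 0, 0, 0, 0, 0, 0, 0, 0, 0, 0, 0, 0, 0]
     = reflection_mat [r, - 1, 1, 0, 0, 0, 0, 0, 0, 0, 0, 0, 0, 0, 0, 0] *\<^sub>v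
       (reflection_mat [0, 0, 0, 0, r, - 1, 1, 0, 0, 0, 0, 0, 0, 0, 0, 0] *\<^sub>v
       (reindex_mat [0, 4, 2, 3, 1, 5, 6, 7, 8, 9, 10, 11, 12, 13, 14, 15] *\<^sub>v
        vec_of_list [p, q, 0, 0, 0, 0, 0, 0, 0, 0, 0, 0, 0, 0, 0, 0]))"
    unfolding prepare_mat_def r_def
    by (intro mult3_mat_vec[of _ 16] reflection_mat_carrier reindex_mat_carrier carrier_vecI) simp_all
  ultimately show ?thesis
    by (simp add: reflection_mat_apply reindex_mat_apply before_query_def Let_def flip: r_def)
      (intro arg_cong[of _ _ vec_of_list]; simp add: field_simps)
qed

lemma swap_apply:
  "reindex_mat swap_xt *\<^sub>v vec_of_list (after_query U p q \<gamma> \<delta>)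
    = vec_of_list (after_query U p q \<delta> \<gamma>)"
  unfolding after_query_def swap_xt_def Let_def
  by (simp add: reindex_mat_apply) (intro arg_cong[of _ _ vec_of_list]; simp)

context
  fixes U :: "complex mat" and a b c d :: complex
  assumes U: "U \<in> carrier_mat 2 2"
    and entries: "U $$ (0,0) = a" "U $$ (0,1) = b" "U $$ (1,0) = c" "U $$ (1,1) = d"
    and det: "a * d = 1 + b * c"
begin

text \<open>This and the next lemma restate a * d = 1 + b * c for right-nested products, with a and
  d adjacent or separated by a factor, to reduce polynomials modulo det U = 1.\<close>

lemma det_assoc: "a * (d * z) = z + b * (c * z)"
  using det by (metis distrib_right mult.assoc mult_1)

lemma det_left_commute: "a * (y * (d * z)) = y * (z + b * (c * z))"
  using det_assoc by (metis mult.left_commute)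

lemma query_before_query:
  "kron_mat (1\<^sub>m 8) U *\<^sub>v vec_of_list (before_query U p q \<gamma> \<delta>)
    = vec_of_list (after_query U p q \<gamma> \<delta>)"
  unfolding before_query_def after_query_def entries Let_def query_apply[OF U entries]
  by (intro arg_cong[of _ _ vec_of_list]; simp add: algebra_simps det det_assoc det_left_commute)

text \<open>The swap of x and t exchanges s and s', so the triplet part carries the factor alpha +
  beta and the singlet part alpha - beta. The former becomes - (alpha + beta) * sqrt 3 / 2 times e,
  the latter (alpha - beta) / sqrt 3 times g - e / 2.\<close>

lemma round_apply:
  "even_mat *\<^sub>v (kron_mat (1\<^sub>m 8) U *\<^sub>v (odd_mat *\<^sub>v vec_of_list (after_query U p q \<alpha> \<beta>)))
    = vec_of_list (before_query U p q (- (2 * \<alpha> + \<beta>) / sqrt 3) ((\<alpha> - \<beta>) / sqrt 3))"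
proof -
  define r where "r = complex_of_real (sqrt 3)"
  have r: "r * r = 3" "r \<noteq> 0" by (simp_all add: r_def sqrt3_sq)
  have r2: "r * (r * z) = 3 * z" for z using r by (simp flip: mult.assoc)
  have odd: "odd_mat *\<^sub>v vec_of_list xs = reindex_mat swap_yt *\<^sub>v (recouple_mat *\<^sub>v vec_of_list xs)"
    and even: "even_mat *\<^sub>v vec_of_list xs
      = reindex_mat swap_xy *\<^sub>v (recouple_mat *\<^sub>v (reindex_mat exchange *\<^sub>v vec_of_list xs))"
    if "length xs = 16" for xs
    unfolding odd_mat_def even_mat_def
    using that unitary_mat_factors[THEN unitary_mat_carrier]
    by (simp_all add: carrier_vecI assoc_mult_mat_vec[of _ 16 16 _ 16] mult3_mat_vec[of _ 16])
  show ?thesis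
    unfolding before_query_def after_query_def entries Let_def r_def[symmetric]
    by (simp add: even odd query_apply[OF U entries] recouple_mat_apply reindex_mat_apply
        Let_def swap_xy_def swap_yt_def exchange_def flip: r_def)
      (intro arg_cong[of _ _ vec_of_list]; simp add: field_simps r r2 det det_assoc)
qed

end

section \<open>Tensor form of input and output, entries of SU(2) matrices, and the circuit\<close>

lemma kron_ket0:
  assumes "\<psi> \<in> carrier_vec 2"
  shows "kron_vec ket0 (kron_vec ket0 (kron_vec ket0 \<psi>))
    = vec_of_list [\<psi> $ 0, \<psi> $ 1, 0, 0, 0, 0, 0, 0, 0, 0, 0, 0, 0, 0, 0, 0]"
    (is "?l = vec_of_list ?r")
proof (rule eq_vecI)
  show dim: "dim_vec ?l = dim_vec (vec_of_list ?r)"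
    using assms by (simp add: kron_vec_def ket0_def)
  fix i assume "i < dim_vec (vec_of_list ?r)"
  then have "i < 16" by simp
  then show "?l $ i = vec_of_list ?r $ i"
    using assms
    by (elim less_16_cases) (simp_all add: kron_vec_def ket0_def vec_of_list_index)
qed

text \<open>Without e only a multiple of g is left, which is a product: the list is proportional to
  U_x S_yx and free of psi.\<close>

lemma before_query_kron:
  assumes \<psi>: "\<psi> \<in> carrier_vec 2" and U: "U \<in> carrier_mat 2 2"
    and inv: "adjoint_mat U $$ (0,0) = U $$ (1,1)" "adjoint_mat U $$ (0,1) = - U $$ (0,1)"
      "adjoint_mat U $$ (1,0) = - U $$ (1,0)" "adjoint_mat U $$ (1,1) = U $$ (0,0)"
  shows "vec_of_list (before_query U (\<psi> $ 0) (\<psi> $ 1) 0 \<delta>)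
    = kron_vec ket0 (kron_vec
        (vec_of_list [\<delta> * U $$ (0,1), - \<delta> * U $$ (0,0), \<delta> * U $$ (1,1), - \<delta> * U $$ (1,0)])
        (adjoint_mat U *\<^sub>v \<psi>))"
    (is "vec_of_list ?l = ?r")
proof (rule eq_vecI)
  have adj: "adjoint_mat U \<in> carrier_mat 2 2"
    using U by (simp add: adjoint_mat_def)
  have out: "(adjoint_mat U *\<^sub>v \<psi>) $ 0 = U $$ (1,1) * \<psi> $ 0 - U $$ (0,1) * \<psi> $ 1"
    "(adjoint_mat U *\<^sub>v \<psi>) $ 1 = U $$ (0,0) * \<psi> $ 1 - U $$ (1,0) * \<psi> $ 0"
    using \<psi> adj inv by (simp_all add: scalar_prod_def numeral_2_eq_2)
  show dim: "dim_vec (vec_of_list ?l) = dim_vec ?r"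
    using adj by (simp add: kron_vec_def ket0_def before_query_def Let_def)
  fix i assume "i < dim_vec ?r"
  then have "i < 16"
    using dim by (simp add: before_query_def Let_def)
  then show "vec_of_list ?l $ i = ?r $ i"
    using adj out
    by (elim less_16_cases) (simp_all add: kron_vec_def ket0_def vec_of_list_index before_query_def Let_def)
qed

lemma SU2_entries:
  assumes "U \<in> SU2"
  shows "U \<in> carrier_mat 2 2"
    and "U $$ (0,0) * U $$ (1,1) = 1 + U $$ (0,1) * U $$ (1,0)"
    and "adjoint_mat U $$ (0,0) = U $$ (1,1)" "adjoint_mat U $$ (0,1) = - U $$ (0,1)"
    and "adjoint_mat U $$ (1,0) = - U $$ (1,0)" "adjoint_mat U $$ (1,1) = U $$ (0,0)"
    and "(cmod (U $$ (0,0)))\<^sup>2 + (cmod (U $$ (0,1)))\<^sup>2 = 1"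
    and "(cmod (U $$ (1,0)))\<^sup>2 + (cmod (U $$ (1,1)))\<^sup>2 = 1"
proof -
  show U: "U \<in> carrier_mat 2 2"
    using assms by (simp add: SU2_def unitary_mat_def)
  define a b c d where abcd: "a = U $$ (0,0)" "b = U $$ (0,1)" "c = U $$ (1,0)" "d = U $$ (1,1)"
  have det: "a * d = 1 + b * c"
  proof -
    have "det U = a * d - b * c"
      using U by (simp add: laplace_expansion_row[OF U, of 0] cofactor_def mat_delete_def
          det_single abcd numeral_2_eq_2)
    then show ?thesis
      using assms by (simp add: SU2_def algebra_simps)
  qed
  then show "U $$ (0,0) * U $$ (1,1) = 1 + U $$ (0,1) * U $$ (1,0)"
    by (simp add: abcd)
  have prod: "(U * adjoint_mat U) $$ (i,j) = U $$ (i,0) * cnj (U $$ (j,0)) + U $$ (i,1) * cnj (U $$ (j,1))"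
    if "i < 2" "j < 2" for i j
    using U that by (simp add: adjoint_mat_def scalar_prod_def numeral_2_eq_2)
  have one: "(U * adjoint_mat U) $$ (i,j) = (if i = j then 1 else 0)" if "i < 2" "j < 2" for i j
    using assms that by (simp add: SU2_def unitary_mat_def)
  have aa: "a * cnj a + b * cnj b = 1" and cc: "c * cnj c + d * cnj d = 1"
    and ca: "c * cnj a + d * cnj b = 0"
    using prod[of 0 0] one[of 0 0] prod[of 1 1] one[of 1 1]
      prod[of 1 0] one[of 1 0] by (simp_all add: abcd)
  show "(cmod (U $$ (0,0)))\<^sup>2 + (cmod (U $$ (0,1)))\<^sup>2 = 1"
    "(cmod (U $$ (1,0)))\<^sup>2 + (cmod (U $$ (1,1)))\<^sup>2 = 1"
    using aa cc unfolding abcd complex_norm_square[symmetric] of_real_add[symmetric] of_real_eq_1_iff .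
  \<comment> \<open>Cramer's rule for the linear equations \<open>aa\<close> and \<open>ca\<close>
    in cnj a and cnj b, whose determinant is 1.\<close>
  have "cnj a = d * (a * cnj a + b * cnj b) - b * (c * cnj a + d * cnj b)"
    using arg_cong[OF det, of "\<lambda>z. z * cnj a"] by (simp add: algebra_simps)
  then have da: "cnj a = d" using aa ca by simp
  have "cnj b = a * (c * cnj a + d * cnj b) - c * (a * cnj a + b * cnj b)"
    using arg_cong[OF det, of "\<lambda>z. z * cnj b"] by (simp add: algebra_simps)
  then have "cnj b = - c" using aa ca by simp
  with da have "cnj a = d" "cnj b = - c" "cnj c = - b" "cnj d = a"
    by (simp, simp, metis complex_cnj_cnj complex_cnj_minus minus_minus, metis complex_cnj_cnj)
  then show "adjoint_mat U $$ (0,0) = U $$ (1,1)" "adjoint_mat U $$ (0,1) = - U $$ (0,1)"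
    "adjoint_mat U $$ (1,0) = - U $$ (1,0)" "adjoint_mat U $$ (1,1) = U $$ (0,0)"
    using U by (simp_all add: adjoint_mat_def abcd)
qed

theorem theorem1:
  shows "\<exists>V0 V1 V2 V3 V4.
     unitary_mat 16 V0 \<and> unitary_mat 16 V1 \<and> unitary_mat 16 V2 \<and>
     unitary_mat 16 V3 \<and> unitary_mat 16 V4 \<and>
     (\<forall>U \<in> SU2. \<exists>\<chi>. unit_state 4 \<chi> \<and>
        (\<forall>\<psi>. unit_state 2 \<psi> \<longrightarrow>
           C_IV V0 V1 V2 V3 V4 U *\<^sub>v kron_vec ket0 (kron_vec ket0 (kron_vec ket0 \<psi>))
             = kron_vec ket0 (kron_vec \<chi> (adjoint_mat U *\<^sub>v \<psi>))))"
proof -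
  let ?Sw = "reindex_mat swap_xt"
  let ?V3 = "odd_mat * ?Sw"
  have unitary: "unitary_mat 16 prepare_mat" "unitary_mat 16 odd_mat" "unitary_mat 16 even_mat"
    "unitary_mat 16 ?Sw" "unitary_mat 16 ?V3"
    unfolding odd_mat_def even_mat_def by (intro unitary_mat_mult unitary_mat_factors)+
  note carriers = unitary[THEN unitary_mat_carrier]
  have main: "\<exists>\<chi>. unit_state 4 \<chi> \<and>
        (\<forall>\<psi>. unit_state 2 \<psi> \<longrightarrow>
           C_IV prepare_mat odd_mat even_mat ?V3 even_mat U *\<^sub>v
             kron_vec ket0 (kron_vec ket0 (kron_vec ket0 \<psi>))
             = kron_vec ket0 (kron_vec \<chi> (adjoint_mat U *\<^sub>v \<psi>)))" if "U \<in> SU2" for U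
  proof (intro exI conjI allI impI)
    note su2 = SU2_entries[OF that]
    define \<delta> where "\<delta> = 1 / complex_of_real (sqrt 2)"
    define r where "r = complex_of_real (sqrt 3)"
    let ?W = "kron_mat (1\<^sub>m 8) U"
    let ?\<chi> = "vec_of_list [\<delta> * U $$ (0,1), - \<delta> * U $$ (0,0), \<delta> * U $$ (1,1), - \<delta> * U $$ (1,0)]"
    have \<delta>: "(cmod \<delta>)\<^sup>2 = 1 / 2"
      by (simp add: \<delta>_def norm_divide power_divide)
    have lessThan4: "{..<4} = {0, 1, 2, 3::nat}" by auto
    have "(\<Sum>i<4. (cmod (?\<chi> $ i))\<^sup>2)
        = (cmod \<delta>)\<^sup>2 * (((cmod (U $$ (0,0)))\<^sup>2 + (cmod (U $$ (0,1)))\<^sup>2)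
            + ((cmod (U $$ (1,0)))\<^sup>2 + (cmod (U $$ (1,1)))\<^sup>2))"
      by (simp add: lessThan4 vec_of_list_index norm_mult power_mult_distrib algebra_simps)
    also have "\<dots> = 1"
      unfolding su2(7,8) \<delta> by simp
    finally show "unit_state 4 ?\<chi>"
      by (simp add: unit_state_def carrier_vecI)
    fix \<psi> assume "unit_state 2 \<psi>"
    then have \<psi>: "\<psi> \<in> carrier_vec 2" by (simp add: unit_state_def)
    let ?B = "\<lambda>\<gamma> \<delta>. vec_of_list (before_query U (\<psi> $ 0) (\<psi> $ 1) \<gamma> \<delta>)"
    let ?A = "\<lambda>\<gamma> \<delta>. vec_of_list (after_query U (\<psi> $ 0) (\<psi> $ 1) \<gamma> \<delta>)"
    let ?x = "vec_of_list [\<psi> $ 0, \<psi> $ 1, 0, 0, 0, 0, 0, 0, 0, 0, 0, 0, 0, 0, 0, 0]"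
    have W: "?W \<in> carrier_mat 16 16" using su2(1) by (simp add: kron_mat_def)
    have x: "?x \<in> carrier_vec 16" by (simp add: carrier_vecI)
    note query = query_before_query[OF su2(1) refl refl refl refl su2(2)]
    note round = round_apply[OF su2(1) refl refl refl refl su2(2)]
    have "C_IV prepare_mat odd_mat even_mat ?V3 even_mat U *\<^sub>v ?x
        = even_mat *\<^sub>v (?W *\<^sub>v (odd_mat *\<^sub>v (?Sw *\<^sub>v (?W *\<^sub>v (even_mat *\<^sub>v (?W *\<^sub>v (odd_mat *\<^sub>v
            (?W *\<^sub>v (prepare_mat *\<^sub>v ?x)))))))))"
      using carriers W x
      by (simp add: C_IV_def Let_def assoc_mult_mat_vec[of _ 16 16 _ 16] mult_carrier_mat[of _ 16 16 _ 16]
          mult_mat_vec_carrier[of _ 16 16])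
    also have "\<dots> = even_mat *\<^sub>v (?W *\<^sub>v (odd_mat *\<^sub>v ?A (\<delta> / r) (- (2 * \<delta>) / r)))"
      \<comment> \<open>The coefficients are (delta, 0) at first and (- 2 delta / r, delta / r)
        after one round; the swap reverses this pair. Then beta = - 2 alpha, so the second round
        cancels e.\<close>
      unfolding prepare_mat_apply[where U = U] query round swap_apply
      by (simp add: \<delta>_def r_def)
    also have "\<dots> = ?B (- (2 * (\<delta> / r) + - (2 * \<delta>) / r) / r) ((\<delta> / r - - (2 * \<delta>) / r) / r)"
      unfolding round r_def ..
    also have "\<dots> = ?B 0 \<delta>"
    proof -
      have "r * r = 3" "r \<noteq> 0" by (simp_all add: r_def sqrt3_sq)
      then have "(\<delta> / r - - (2 * \<delta>) / r) / r = \<delta>" by (simp add: field_simps)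
      then show ?thesis by simp
    qed
    also have "\<dots> = kron_vec ket0 (kron_vec ?\<chi> (adjoint_mat U *\<^sub>v \<psi>))"
      by (rule before_query_kron[OF \<psi> su2(1,3,4,5,6)])
    finally show "C_IV prepare_mat odd_mat even_mat ?V3 even_mat U *\<^sub>v
             kron_vec ket0 (kron_vec ket0 (kron_vec ket0 \<psi>))
             = kron_vec ket0 (kron_vec ?\<chi> (adjoint_mat U *\<^sub>v \<psi>))"
      by (simp only: kron_ket0[OF \<psi>])
  qed
  show ?thesis
    by (rule exI[of _ prepare_mat], rule exI[of _ odd_mat], rule exI[of _ even_mat],
        rule exI[of _ ?V3], rule exI[of _ even_mat], intro conjI ballI unitary main)
qed

end
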